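(* Let $p$ be an odd prime, $n\ge3$, $2\le m\le n-1$, and let $I$ be the unsaturated generalized order ideal of $\mathbb{GH}(m,n)$ in which every element of $[n]$ has multiplicity $p-1$. Let $f:\mathbb{F}_p^n\to\mathbb{F}_p$ be the characteristic function of $I(\mathbb{GP})\setminus\{0\}$ (unsaturated notion). Then the code \[ \mathcal{C}_f=\{(sf(x)+u\cdot x)_{x\in\mathbb{F}_p^n\setminus0}:\ s\in\mathbb{F}_p,\ u\in\mathbb{F}_p^n\} \] violates the Ashikhmin--Barg condition.
   Context: $[n]=\{1,\dots,n\}$; $u\cdot x=\sum_i u_ix_i$. The Ashikhmin--Barg condition for a linear code over $\mathbb{F}_p$ is $w_{\min}/w_{\max}>(p-1)/p$, where $w_{\min},w_{\max}$ are the smallest and largest nonzero Hamming weights; a code violates it if the inequality fails. Generalized order ideals: $[n]_{p-1}$ is the multiset in which each $i\in[n]$ has multiplicity $p-1$. A sub-multiset $J$ is identified with its multiplicity vector $(J_1,\dots,J_n)\in\{0,\dots,p-1\}^n=\mathbb{F}_p^n$; $J\subseteq J'$ means $J_i\le J'_i$ (as integers) for all $i$; $\bar J=\{i:J_i\ne0\}$. The hierarchical poset $\mathbb{H}(m,n)$ on $[n]$ has as its only strict relations $i\prec j$ for all $i\in[m]$, $j\in[n]\setminus[m]$; $\mathbb{GH}(m,n)$ denotes $[n]_{p-1}$ together with this order. $J$ is an unsaturated generalized order ideal if $\bar J$ is an order ideal (down-closed subset) of $\mathbb{H}(m,n)$. For an unsaturated generalized order ideal $I$, $I(\mathbb{GP})\subseteq\mathbb{F}_p^n$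 is the set of all unsaturated generalized order ideals contained in $I$. Thus for the $I$ considered here, $I(\mathbb{GP})=(\mathbb{F}_p^m\times0)\cup((\mathbb{F}_p^* )^m\times(\mathbb{F}_p^{n-m}\setminus0))$. *)

theory Defs
  imports
    "Berlekamp_Zassenhaus.Finite_Field"
    "HOL-Library.Multiset"
    "HOL-Library.FuncSet"
    "HOL-Library.Indicator_Function"
begin

(* The prime field F_p is 'p mod_ring with p = CARD('p) and 'p of class prime_card.
   F_p^n consists of the functions {1..n} -> F_p that are undefined outside {1..n}, so that
   the coordinates carry the labels 1, ..., n used by the poset. *)

definition Fp_space :: "nat \<Rightarrow> (nat \<Rightarrow> 'p::prime_card mod_ring) set" where
  "Fp_space n = {1..n} \<rightarrow>\<^sub>E UNIV"

definition zero_vec :: "nat \<Rightarrow> nat \<Rightarrow> 'p::prime_card mod_ring" where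
  "zero_vec n = (\<lambda>i\<in>{1..n}. 0)"

definition dot :: "nat \<Rightarrow> (nat \<Rightarrow> 'p::prime_card mod_ring) \<Rightarrow> (nat \<Rightarrow> 'p mod_ring) \<Rightarrow> 'p mod_ring" where
  "dot n u x = (\<Sum>i=1..n. u i * x i)"


definition full_multiset :: "nat \<Rightarrow> nat \<Rightarrow> nat multiset" where
  "full_multiset p n = (\<Sum>i=1..n. replicate_mset (p - 1) i)"

(* The multiplicities of a sub-multiset of full_multiset p n are at most p - 1,
   so of_nat is injective on them. *)
definition multiplicity_vector :: "nat \<Rightarrow> nat multiset \<Rightarrow> nat \<Rightarrow> 'p::prime_card mod_ring" where
  "multiplicity_vector n J = (\<lambda>i\<in>{1..n}. of_nat (count J i))"

definition hierarchical_le :: "nat \<Rightarrow> nat \<Rightarrow> nat \<Rightarrow> nat \<Rightarrow> bool" where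
  "hierarchical_le m n i j \<longleftrightarrow> i = j \<or> (i \<in> {1..m} \<and> j \<in> {1..n} - {1..m})"

definition order_ideal :: "'a set \<Rightarrow> ('a \<Rightarrow> 'a \<Rightarrow> bool) \<Rightarrow> 'a set \<Rightarrow> bool" where
  "order_ideal P prec A \<longleftrightarrow> A \<subseteq> P \<and> (\<forall>j\<in>A. \<forall>i\<in>P. prec i j \<longrightarrow> i \<in> A)"

definition unsaturated_ideal :: "nat \<Rightarrow> nat \<Rightarrow> (nat \<Rightarrow> nat \<Rightarrow> bool) \<Rightarrow> nat multiset \<Rightarrow> bool" where
  "unsaturated_ideal p n prec J \<longleftrightarrow>
     J \<subseteq># full_multiset p n \<and> order_ideal {1..n} prec (set_mset J)"

definition ideals_within ::
  "nat \<Rightarrow> (nat \<Rightarrow> nat \<Rightarrow> bool) \<Rightarrow> nat multiset \<Rightarrow> (nat \<Rightarrow> 'p::prime_card mod_ring) set" where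
  "ideals_within n prec I =
     multiplicity_vector n ` {J. unsaturated_ideal CARD('p) n prec J \<and> J \<subseteq># I}"


(* A code of finite length with coordinate set D is a set of functions on D; its codewords are
   undefined outside D. *)

definition hamming_weight :: "'i set \<Rightarrow> ('i \<Rightarrow> 'p::prime_card mod_ring) \<Rightarrow> nat" where
  "hamming_weight D c = card {x \<in> D. c x \<noteq> 0}"

definition nonzero_weights :: "'i set \<Rightarrow> ('i \<Rightarrow> 'p::prime_card mod_ring) set \<Rightarrow> nat set" where
  "nonzero_weights D C = hamming_weight D ` C - {0}"

definition w_min :: "'i set \<Rightarrow> ('i \<Rightarrow> 'p::prime_card mod_ring) set \<Rightarrow> nat" where
  "w_min D C = Min (nonzero_weights D C)"

definition w_max :: "'i set \<Rightarrow> ('i \<Rightarrow> 'p::prime_card mod_ring) set \<Rightarrow> nat" where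
  "w_max D C = Max (nonzero_weights D C)"

definition ashikhmin_barg :: "'i set \<Rightarrow> ('i \<Rightarrow> 'p::prime_card mod_ring) set \<Rightarrow> bool" where
  "ashikhmin_barg D C \<longleftrightarrow>
     real (w_min D C) / real (w_max D C) > (real CARD('p) - 1) / real CARD('p)"

definition function_code ::
  "nat \<Rightarrow> ((nat \<Rightarrow> 'p::prime_card mod_ring) \<Rightarrow> 'p mod_ring)
     \<Rightarrow> ((nat \<Rightarrow> 'p mod_ring) \<Rightarrow> 'p mod_ring) set" where
  "function_code n f =
     {(\<lambda>x\<in>Fp_space n - {zero_vec n}. s * f x + dot n u x) | s u. u \<in> Fp_space n}"

end

theory Submission
  imports Defs
begin

text \<open>
  The condition fails as soon as two nonzero weights \<open>w, w'\<close> satisfy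
  \<open>p w \<le> (p - 1) w'\<close>.  Such weights can be found among the words \<open>f + u \<cdot> x\<close> with \<open>u\<close> one of
  \<open>0\<close>, \<open>e\<^sub>1\<close>, \<open>e\<^sub>n\<close>.

  Write \<open>T\<close> for the set of all ideals, so that \<open>f\<close> is the indicator of \<open>T - {0}\<close>.  Counting
  the zeros of \<open>f + u \<cdot> x\<close> inside and outside \<open>T\<close> gives
    \<open>wt = p\<^sup>n - #{u \<cdot> x = 0} + #{x \<in> T. u \<cdot> x = 0} - #{x \<in> T. u \<cdot> x = -1} - 1\<close>
  (lemma \<open>hamming_weight_indicator_plus\<close>).  The set \<open>T\<close> is the union of the two boxes
  \<open>F\<^sup>m \<times> 0\<close> and \<open>(F - 0)\<^sup>m \<times> F\<^bsup>n-m\<^esup>\<close>, whose intersection is again a box; hence each of these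
  numbers is an integer combination of sizes of boxes with at most one coordinate fixed.  With
  \<open>a = p - 1\<close> the three weights are

  \<^item> \<open>p\<^sup>m + a\<^sup>m p\<^bsup>n-m\<^esup> - a\<^sup>m - 1\<close> for \<open>u = 0\<close>,
  \<^item> \<open>p\<^sup>n + a\<^bsup>m-1\<^esup> - p\<^bsup>n-1\<^esup> - a\<^bsup>m-1\<^esup> p\<^bsup>n-m\<^esup> - 1\<close> for \<open>u = e\<^sub>1\<close>,
  \<^item> \<open>p\<^sup>n + p\<^sup>m - p\<^bsup>n-1\<^esup> - a\<^sup>m - 1\<close> for \<open>u = e\<^sub>n\<close>.

  The last one serves as \<open>w'\<close>.  For \<open>m \<ge> 3\<close> the first one is small enough to serve as \<open>w\<close>.  For
  \<open>m = 2\<close> it need not be (it fails for \<open>n = 3\<close>), but the second one is, and there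
  \<open>(p - 1) w' - p w = a\<^sup>2 + 1\<close> for every \<open>n\<close>.
\<close>

section \<open>Boxes in the space of vectors\<close>

text \<open>The vectors, with coordinates labelled \<open>1, ..., n\<close> and undefined elsewhere, whose first
  \<open>m\<close> coordinates lie in \<open>A\<close> and whose remaining coordinates lie in \<open>B\<close>.\<close>

definition two_block_box :: "nat \<Rightarrow> nat \<Rightarrow> 'b set \<Rightarrow> 'b set \<Rightarrow> (nat \<Rightarrow> 'b) set" where
  "two_block_box m n A B = (\<Pi>\<^sub>E i\<in>{1..n}. if i \<le> m then A else B)"

lemma two_block_box_iff:
  "x \<in> two_block_box m n A B \<longleftrightarrow>
     x \<in> extensional {1..n} \<and> (\<forall>i\<in>{1..n}. x i \<in> (if i \<le> m then A else B))"
  by (auto simp: two_block_box_def PiE_iff)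

lemma two_block_box_Int:
  "two_block_box m n A B \<inter> two_block_box m n A' B' = two_block_box m n (A \<inter> A') (B \<inter> B')"
  unfolding set_eq_iff Int_iff two_block_box_iff by (auto split: if_splits)

lemma finite_box: "finite A \<Longrightarrow> finite B \<Longrightarrow> finite (two_block_box m n A B)"
  unfolding two_block_box_def by (intro finite_PiE) auto

lemma prod_two_blocks:
  fixes a b :: "'b::comm_monoid_mult"
  assumes "m \<le> n"
  shows "(\<Prod>i=1..n. if i \<le> m then a else b) = a ^ m * b ^ (n - m)"
proof -
  have "{1..n} = {1..m} \<union> {m+1..n}" using assms by auto
  then have "(\<Prod>i=1..n. if i \<le> m then a else b)
      = (\<Prod>i=1..m. if i \<le> m then a else b) * (\<Prod>i=m+1..n. if i \<le> m then a else b)"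
    by (simp add: prod.union_disjoint)
  then show ?thesis by simp
qed

lemma card_box: "m \<le> n \<Longrightarrow> card (two_block_box m n A B) = card A ^ m * card B ^ (n - m)"
  using prod_two_blocks[of m n "card A" "card B"]
  by (simp add: two_block_box_def card_PiE if_distrib cong: if_cong)

lemma card_box_first:
  assumes "1 \<le> m" "m \<le> n"
  shows "card {x \<in> two_block_box m n A B. x 1 = c} =
           (if c \<in> A then card A ^ (m - 1) * card B ^ (n - m) else 0)"
proof (cases "c \<in> A")
  case True
  let ?F = "\<lambda>i::nat. if i = 1 then {c} else if i \<le> m then A else B"
  have "{x \<in> two_block_box m n A B. x 1 = c} = (\<Pi>\<^sub>E i\<in>{1..n}. ?F i)"
    using assms True by (auto simp: two_block_box_def PiE_iff extensional_def split: if_splits)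
  then have "card {x \<in> two_block_box m n A B. x 1 = c} = (\<Prod>i=1..n. card (?F i))"
    by (simp add: card_PiE)
  also have "\<dots> = (\<Prod>i=2..n. if i \<le> m then card A else card B)"
    using assms by (simp add: prod.atLeast_Suc_atMost numeral_2_eq_2 if_distrib cong: if_cong)
  also have "\<dots> = (\<Prod>i=1..n-1. if i \<le> m - 1 then card A else card B)"
    by (rule prod.reindex_bij_witness[of _ Suc "\<lambda>i. i - 1"]) (use assms in auto)
  also have "\<dots> = card A ^ (m - 1) * card B ^ (n - m)"
    using assms prod_two_blocks[of "m - 1" "n - 1" "card A" "card B"] by simp
  finally show ?thesis using True by simp
next
  case False
  then have "{x \<in> two_block_box m n A B. x 1 = c} = {}" using assms by (force simp: two_block_box_iff)
  with False show ?thesis by (simp only: card.empty if_False)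
qed

lemma card_box_last:
  assumes "m < n"
  shows "card {x \<in> two_block_box m n A B. x n = c} =
           (if c \<in> B then card A ^ m * card B ^ (n - 1 - m) else 0)"
proof (cases "c \<in> B")
  case True
  let ?F = "\<lambda>i::nat. if i = n then {c} else if i \<le> m then A else B"
  have n: "n = Suc (n - 1)" using assms by simp
  have "{x \<in> two_block_box m n A B. x n = c} = (\<Pi>\<^sub>E i\<in>{1..n}. ?F i)"
    using assms True by (auto simp: two_block_box_def PiE_iff extensional_def split: if_splits)
  then have "card {x \<in> two_block_box m n A B. x n = c} = (\<Prod>i=1..n. card (?F i))"
    by (simp add: card_PiE)
  also have "\<dots> = (\<Prod>i=1..n-1. card (?F i)) * card (?F n)"
    using prod.cl_ivl_Suc[of "\<lambda>i. card (?F i)" 1 "n - 1"] n by simp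
  also have "\<dots> = (\<Prod>i=1..n-1. if i \<le> m then card A else card B)"
    by (simp, rule prod.cong) auto
  also have "\<dots> = card A ^ m * card B ^ (n - 1 - m)"
    using assms by (intro prod_two_blocks) auto
  finally show ?thesis using True by simp
next
  case False
  then have "{x \<in> two_block_box m n A B. x n = c} = {}" using assms by (force simp: two_block_box_iff)
  with False show ?thesis by (simp only: card.empty if_False)
qed

section \<open>The ideals of the hierarchical poset\<close>

text \<open>The multiplicity vectors of all unsaturated ideals, described by their supports: the support
  lies in the lower block \<open>{1..m}\<close>, or it contains that block.\<close>

definition hier_set :: "nat \<Rightarrow> nat \<Rightarrow> (nat \<Rightarrow> 'p::prime_card mod_ring) set" where
  "hier_set m n = two_block_box m n UNIV {0} \<union> two_block_box m n (UNIV - {0}) UNIV"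

lemma count_full_multiset:
  "count (full_multiset p n) i = (if i \<in> {1..n} then p - 1 else 0)"
  by (simp add: full_multiset_def count_sum)

lemma of_nat_mod_ring_eq_0_iff:
  "k < CARD('p) \<Longrightarrow> (of_nat k :: 'p::prime_card mod_ring) = 0 \<longleftrightarrow> k = 0"
  by (auto dest!: of_nat_0_mod_ring_dvd dest: dvd_imp_le)

lemma order_ideal_hierarchical:
  assumes "m \<le> n"
  shows "order_ideal {1..n} (hierarchical_le m n) A \<longleftrightarrow>
           A \<subseteq> {1..n} \<and> (A \<subseteq> {1..m} \<or> {1..m} \<subseteq> A)"
proof (intro iffI conjI)
  assume A: "order_ideal {1..n} (hierarchical_le m n) A"
  then show "A \<subseteq> {1..n}" by (simp only: order_ideal_def)
  show "A \<subseteq> {1..m} \<or> {1..m} \<subseteq> A"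
  proof (rule disjCI)
    assume "\<not> {1..m} \<subseteq> A"
    then obtain i where i: "i \<in> {1..m}" "i \<notin> A" by blast
    show "A \<subseteq> {1..m}"
    proof
      fix j assume j: "j \<in> A"
      show "j \<in> {1..m}"
      proof (rule ccontr)
        assume "j \<notin> {1..m}"
        with A i j assms have "hierarchical_le m n i j" "i \<in> {1..n}"
          by (auto simp: order_ideal_def hierarchical_le_def)
        with A i j show False unfolding order_ideal_def by blast
      qed
    qed
  qed
next
  assume "A \<subseteq> {1..n} \<and> (A \<subseteq> {1..m} \<or> {1..m} \<subseteq> A)"
  then show "order_ideal {1..n} (hierarchical_le m n) A"
    unfolding order_ideal_def hierarchical_le_def by blast
qed

text \<open>When every multiplicity in \<open>I\<close> is \<open>p - 1\<close>, containment in \<open>I\<close> imposes nothing beyond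
  containment in the full multiset.  As multiplicities stay below \<open>p\<close>, a coordinate of the
  multiplicity vector vanishes exactly when the multiplicity does.\<close>

lemma ideals_within_full:
  fixes I :: "nat multiset"
  assumes "m \<le> n" and I: "\<forall>i\<in>{1..n}. count I i = CARD('p) - 1"
  shows "(ideals_within n (hierarchical_le m n) I :: (nat \<Rightarrow> 'p::prime_card mod_ring) set)
           = hier_set m n"
proof (intro Set.set_eqI iffI)
  fix x :: "nat \<Rightarrow> 'p mod_ring"
  have p: "CARD('p) > 0" by simp
  assume "x \<in> ideals_within n (hierarchical_le m n) I"
  then obtain J where J: "unsaturated_ideal CARD('p) n (hierarchical_le m n) J"
    and x: "x = multiplicity_vector n J" unfolding ideals_within_def by auto
  have le: "count J i \<le> CARD('p) - 1" for i
  proof -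
    have "count J i \<le> count (full_multiset CARD('p) n) i"
      using J by (auto simp: unsaturated_ideal_def mset_subset_eq_count)
    then show ?thesis by (auto simp: count_full_multiset split: if_splits)
  qed
  then have lt: "count J i < CARD('p)" for i using le[of i] p by linarith
  have zero: "x i = 0 \<longleftrightarrow> i \<notin># J" if "i \<in> {1..n}" for i
    using that lt[of i] by (simp add: x multiplicity_vector_def of_nat_mod_ring_eq_0_iff
        not_in_iff)
  have ext: "x \<in> extensional {1..n}" by (simp add: x multiplicity_vector_def)
  have "set_mset J \<subseteq> {1..m} \<or> {1..m} \<subseteq> set_mset J"
    using J order_ideal_hierarchical[OF assms(1), of "set_mset J"]
    unfolding unsaturated_ideal_def by blast
  then show "x \<in> hier_set m n"
  proof
    assume "set_mset J \<subseteq> {1..m}"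
    then have "x \<in> two_block_box m n UNIV {0}" using zero ext by (fastforce simp: two_block_box_iff)
    then show ?thesis by (simp add: hier_set_def)
  next
    assume "{1..m} \<subseteq> set_mset J"
    then have "x \<in> two_block_box m n (UNIV - {0}) UNIV" using zero ext by (fastforce simp: two_block_box_iff)
    then show ?thesis by (simp add: hier_set_def)
  qed
next
  fix x :: "nat \<Rightarrow> 'p mod_ring"
  assume x: "x \<in> hier_set m n"
  have "\<forall>i. \<exists>k. k < CARD('p) \<and> x i = of_nat k"
    using surj_of_nat_mod_ring by blast
  then obtain k where "\<forall>i. k i < CARD('p) \<and> x i = of_nat (k i)"
    by (rule choice[THEN exE])
  then have k: "\<And>i. k i < CARD('p)" "\<And>i. x i = of_nat (k i)" by auto
  define J where "J = (\<Sum>i=1..n. replicate_mset (k i) i)"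
  have cJ: "count J i = (if i \<in> {1..n} then k i else 0)" for i
    by (simp add: J_def count_sum)
  have ext: "x \<in> extensional {1..n}" using x by (auto simp: hier_set_def two_block_box_iff)
  have le: "k i \<le> CARD('p) - 1" for i using k(1)[of i] by linarith
  have J1: "J \<subseteq># full_multiset CARD('p) n"
    using le by (auto simp: subseteq_mset_def cJ count_full_multiset)
  have J2: "J \<subseteq># I"
    using le I by (auto simp: subseteq_mset_def cJ)
  have mem: "i \<in># J \<longleftrightarrow> i \<in> {1..n} \<and> x i \<noteq> 0" for i
    unfolding count_greater_zero_iff[symmetric] cJ k(2) of_nat_mod_ring_eq_0_iff[OF k(1)]
    by auto
  have "set_mset J \<subseteq> {1..m} \<or> {1..m} \<subseteq> set_mset J"
    using x assms(1) unfolding hier_set_def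
    by (fastforce simp: two_block_box_iff mem subset_iff split: if_splits)
  then have J3: "order_ideal {1..n} (hierarchical_le m n) (set_mset J)"
    using mem order_ideal_hierarchical[OF assms(1), of "set_mset J"] by blast
  have "x = multiplicity_vector n J"
    using ext by (auto simp: multiplicity_vector_def fun_eq_iff cJ k(2)[symmetric]
        extensional_def)
  then show "x \<in> ideals_within n (hierarchical_le m n) I"
    using J1 J2 J3 unfolding ideals_within_def unsaturated_ideal_def by auto
qed

text \<open>Inclusion-exclusion for the two boxes that make up \<^const>\<open>hier_set\<close>; stated with sums
  on both sides to avoid truncated subtraction.\<close>

lemma card_hier_set_restrict:
  "card {x \<in> hier_set m n :: (nat \<Rightarrow> 'p::prime_card mod_ring) set. P x}
     + card {x \<in> two_block_box m n (UNIV - {0 :: 'p mod_ring}) {0}. P x}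
   = card {x \<in> two_block_box m n UNIV {0 :: 'p mod_ring}. P x}
     + card {x \<in> two_block_box m n (UNIV - {0 :: 'p mod_ring}) UNIV. P x}"
proof -
  let ?A = "{x \<in> two_block_box m n UNIV {0 :: 'p mod_ring}. P x}"
  let ?B = "{x \<in> two_block_box m n (UNIV - {0 :: 'p mod_ring}) UNIV. P x}"
  have "{x \<in> hier_set m n. P x} = ?A \<union> ?B" by (auto simp: hier_set_def)
  moreover have "{x \<in> two_block_box m n (UNIV - {0 :: 'p mod_ring}) {0}. P x} = ?A \<inter> ?B"
    using two_block_box_Int[of m n UNIV "{0 :: 'p mod_ring}" "UNIV - {0}" UNIV] by auto
  ultimately show ?thesis
    using card_Un_Int[of ?A ?B] by (simp add: finite_box)
qed

lemma Fp_space_eq_box: "Fp_space n = two_block_box m n UNIV UNIV"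
  by (simp add: Fp_space_def two_block_box_def)

lemma card_nonzero_mod_ring: "card (UNIV - {0 :: 'p::prime_card mod_ring}) = CARD('p) - 1"
  by (simp add: card_Diff_singleton)

section \<open>Weights of codewords\<close>

text \<open>The zeros of \<open>1\<^bsub>T - {z}\<^esub> + L\<close> on \<open>V\<close> are the zeros of \<open>L\<close> outside \<open>T\<close>, the points
  of \<open>T\<close> with \<open>L = -1\<close>, and \<open>z\<close>.  The summand 1 stands for \<open>z\<close>, which is not a
  coordinate of the code.\<close>

lemma hamming_weight_indicator_plus:
  fixes L :: "'v \<Rightarrow> 'p::prime_card mod_ring"
  assumes V: "finite V" and TV: "T \<subseteq> V" and z: "z \<in> T" "L z = 0"
  shows "hamming_weight (V - {z}) (\<lambda>x\<in>V - {z}. indicator (T - {z}) x + L x)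
           + card {x \<in> V. L x = 0} + card {x \<in> T. L x = - 1} + 1
         = card V + card {x \<in> T. L x = 0}"
proof -
  let ?W = "{x \<in> V - {z}. indicator (T - {z}) x + L x \<noteq> 0}"
  let ?Z = "{x \<in> V - T. L x = 0}"
  let ?T0 = "{x \<in> T. L x = 0}"
  let ?T1 = "{x \<in> T. L x = - 1}"
  have T: "finite T" using V TV by (rule finite_subset[rotated])
  have hw: "hamming_weight (V - {z}) (\<lambda>x\<in>V - {z}. indicator (T - {z}) x + L x) = card ?W"
    unfolding hamming_weight_def by (rule arg_cong[of _ _ card]) auto
  have "V = ?W \<union> (?Z \<union> (?T1 \<union> {z}))"
    using z TV by (auto simp: indicator_def add_eq_0_iff)
  then have "card V = card (?W \<union> (?Z \<union> (?T1 \<union> {z})))" by simp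
  also have "\<dots> = card ?W + card (?Z \<union> (?T1 \<union> {z}))"
    using V T z by (intro card_Un_disjoint) (auto simp: indicator_def)
  also have "card (?Z \<union> (?T1 \<union> {z})) = card ?Z + card (?T1 \<union> {z})"
    using V T z by (intro card_Un_disjoint) auto
  also have "card (?T1 \<union> {z}) = card ?T1 + 1"
    using T z by simp
  finally have cV: "card V = card ?W + (card ?Z + (card ?T1 + 1))" .
  have "{x \<in> V. L x = 0} = ?Z \<union> ?T0" using TV by auto
  moreover have "card (?Z \<union> ?T0) = card ?Z + card ?T0"
    using V T by (intro card_Un_disjoint) auto
  ultimately show ?thesis using cV hw by simp
qed

lemma not_ashikhmin_bargI:
  fixes C :: "('i \<Rightarrow> 'p::prime_card mod_ring) set"
  assumes D: "finite D" and c: "c \<in> C" "c' \<in> C"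
    and pos: "hamming_weight D c > 0" "hamming_weight D c' > 0"
    and le: "real CARD('p) * real (hamming_weight D c)
               \<le> (real CARD('p) - 1) * real (hamming_weight D c')"
  shows "\<not> ashikhmin_barg D C"
proof -
  have "nonzero_weights D C \<subseteq> {..card D}"
    using D by (auto simp: nonzero_weights_def hamming_weight_def intro!: card_mono)
  then have fin: "finite (nonzero_weights D C)" by (rule finite_subset) simp
  have min: "w_min D C \<le> hamming_weight D c"
    unfolding w_min_def using fin c pos by (intro Min_le) (auto simp: nonzero_weights_def)
  have max: "hamming_weight D c' \<le> w_max D C"
    unfolding w_max_def using fin c pos by (intro Max_ge) (auto simp: nonzero_weights_def)
  have p: "real CARD('p) \<ge> 1" using one_le_card_finite[where 'a='p] by linarith
  have "real CARD('p) * real (w_min D C) \<le> real CARD('p) * real (hamming_weight D c)"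
    using min by simp
  also have "\<dots> \<le> (real CARD('p) - 1) * real (hamming_weight D c')" by (rule le)
  also have "\<dots> \<le> (real CARD('p) - 1) * real (w_max D C)"
    using max p by (intro mult_left_mono) auto
  finally have "real CARD('p) * real (w_min D C) \<le> (real CARD('p) - 1) * real (w_max D C)" .
  moreover have "real (w_max D C) > 0" using max pos by linarith
  ultimately show ?thesis
    using p unfolding ashikhmin_barg_def by (simp add: field_simps)
qed

lemma dot_unit_vector:
  "k \<in> {1..n} \<Longrightarrow> dot n (\<lambda>i\<in>{1..n}. if i = k then 1 else 0) x = x k"
  by (simp add: dot_def if_distrib[of "\<lambda>a. a * _"] cong: if_cong)

lemma dot_zero_vec: "dot n (zero_vec n) x = 0"
  by (simp add: dot_def zero_vec_def)

lemma dot_zero_right: "dot n u (zero_vec n) = 0"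
  by (simp add: dot_def zero_vec_def)

lemma zero_vec_mem_hier_set: "zero_vec n \<in> hier_set m n"
  unfolding hier_set_def by (intro UnI1) (simp add: two_block_box_iff zero_vec_def)

lemma finite_Fp_space: "finite (Fp_space n)"
  by (simp add: Fp_space_eq_box[of n 0] finite_box)

lemma hier_set_subset: "hier_set m n \<subseteq> Fp_space n"
  by (auto simp: hier_set_def Fp_space_eq_box[of n m] two_block_box_iff)

text \<open>The codeword with \<open>s = 1\<close> and the given \<open>u\<close>.\<close>

definition ideal_word ::
  "nat \<Rightarrow> nat \<Rightarrow> (nat \<Rightarrow> 'p::prime_card mod_ring) \<Rightarrow> (nat \<Rightarrow> 'p mod_ring) \<Rightarrow> 'p mod_ring" where
  "ideal_word m n u = (\<lambda>x\<in>Fp_space n - {zero_vec n}.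
     indicator (hier_set m n - {zero_vec n}) x + dot n u x)"

lemma ideal_word_mem:
  "u \<in> Fp_space n \<Longrightarrow>
     ideal_word m n u \<in> function_code n (indicator (hier_set m n - {zero_vec n}))"
  unfolding function_code_def ideal_word_def
  by (intro CollectI exI[of _ 1] exI[of _ u]) simp

lemma weight_ideal_word:
  fixes u :: "nat \<Rightarrow> 'p::prime_card mod_ring"
  shows "hamming_weight (Fp_space n - {zero_vec n}) (ideal_word m n u)
           + card {x \<in> Fp_space n. dot n u x = 0}
           + card {x \<in> hier_set m n. dot n u x = - 1} + 1
         = card (Fp_space n :: (nat \<Rightarrow> 'p mod_ring) set)
           + card {x \<in> hier_set m n. dot n u x = 0}"
  unfolding ideal_word_def
  by (rule hamming_weight_indicator_plus)
    (simp_all add: finite_Fp_space hier_set_subset zero_vec_mem_hier_set dot_zero_right)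

lemma card_Fp_space: "card (Fp_space n :: (nat \<Rightarrow> 'p::prime_card mod_ring) set) = CARD('p) ^ n"
  by (simp add: Fp_space_eq_box[of n 0] card_box)

lemma weight_ideal_word_zero:
  assumes "m \<le> n"
  shows "hamming_weight (Fp_space n - {zero_vec n})
           (ideal_word m n (zero_vec n :: nat \<Rightarrow> 'p::prime_card mod_ring))
           + (CARD('p) - 1) ^ m + 1
         = CARD('p) ^ m + (CARD('p) - 1) ^ m * CARD('p) ^ (n - m)"
  using weight_ideal_word[of n m "zero_vec n :: nat \<Rightarrow> 'p mod_ring"]
    card_hier_set_restrict[of m n "\<lambda>x :: nat \<Rightarrow> 'p mod_ring. True"] assms
  by (simp add: dot_zero_vec card_Fp_space card_box card_nonzero_mod_ring)

lemma weight_ideal_word_last: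
  assumes "m < n"
  shows "hamming_weight (Fp_space n - {zero_vec n})
           (ideal_word m n (\<lambda>i\<in>{1..n}. if i = n then 1 else 0 :: 'p::prime_card mod_ring))
           + CARD('p) ^ (n - 1) + (CARD('p) - 1) ^ m + 1
         = CARD('p) ^ n + CARD('p) ^ m"
proof -
  let ?u = "\<lambda>i\<in>{1..n}. if i = n then 1 else 0 :: 'p mod_ring"
  have n: "n \<in> {1..n}" using assms by simp
  have V: "card {x \<in> Fp_space n. x n = (0 :: 'p mod_ring)} = CARD('p) ^ (n - 1)"
    using assms by (simp add: Fp_space_eq_box[of n m] card_box_last flip: power_add)
  show ?thesis
    using weight_ideal_word[of n m ?u] V
      card_hier_set_restrict[of m n "\<lambda>x. x n = (0 :: 'p mod_ring)"]
      card_hier_set_restrict[of m n "\<lambda>x. x n = (- 1 :: 'p mod_ring)"] assms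
    unfolding dot_unit_vector[OF n]
    by (simp add: card_Fp_space card_box_last card_nonzero_mod_ring)
qed

lemma weight_ideal_word_first:
  assumes "1 \<le> m" "m \<le> n"
  shows "hamming_weight (Fp_space n - {zero_vec n})
           (ideal_word m n (\<lambda>i\<in>{1..n}. if i = 1 then 1 else 0 :: 'p::prime_card mod_ring))
           + CARD('p) ^ (n - 1) + (CARD('p) - 1) ^ (m - 1) * CARD('p) ^ (n - m) + 1
         = CARD('p) ^ n + (CARD('p) - 1) ^ (m - 1)"
proof -
  let ?u = "\<lambda>i\<in>{1..n}. if i = 1 then 1 else 0 :: 'p mod_ring"
  have n: "1 \<in> {1..n}" using assms by simp
  have V: "card {x \<in> Fp_space n. x 1 = (0 :: 'p mod_ring)} = CARD('p) ^ (n - 1)"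
    unfolding Fp_space_eq_box[of n m] card_box_first[OF assms]
    using assms by (simp flip: power_add)
  show ?thesis
    using weight_ideal_word[of n m ?u] V
      card_hier_set_restrict[of m n "\<lambda>x. x 1 = (0 :: 'p mod_ring)"]
      card_hier_set_restrict[of m n "\<lambda>x. x 1 = (- 1 :: 'p mod_ring)"]
    unfolding dot_unit_vector[OF n] card_box_first[OF assms]
    by (simp add: card_Fp_space card_nonzero_mod_ring)
qed

section \<open>Comparison of the weights\<close>

text \<open>Since \<open>p\<^sup>n - p\<^bsup>n-1\<^esup> = a p\<^bsup>n-1\<^esup>\<close>, the inequality amounts to
  \<open>p\<^sup>m - 1 - a\<^sup>m \<le> p\<^bsup>n-m+1\<^esup> a\<^sup>2 (p\<^bsup>m-2\<^esup> - a\<^bsup>m-2\<^esup>)\<close>.  Here \<open>p\<^bsup>m-2\<^esup> - a\<^bsup>m-2\<^esup> \<ge> p\<^bsup>m-3\<^esup>\<close> and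
  \<open>a\<^sup>2 \<ge> p\<close> (because \<open>p \<ge> 3\<close>), so that the right-hand side is at least \<open>p\<^sup>m\<close>.\<close>

lemma weight_comparison_ge_3:
  fixes P a :: real
  assumes P: "P \<ge> 3" "P = a + 1" and mn: "3 \<le> m" "m < n"
  shows "P * (P ^ m + a ^ m * P ^ (n - m) - a ^ m - 1)
           \<le> a * (P ^ n + P ^ m - P ^ (n - 1) - a ^ m - 1)"
proof -
  obtain j where j: "m = 3 + j" using mn(1) le_Suc_ex by blast
  obtain l where l: "n = Suc (m + l)" using mn(2) less_imp_Suc_add by blast
  \<comment> \<open>The powers that remain after the fixed part of each exponent is split off.\<close>
  define X Y K where "X = P ^ j" and "Y = a ^ j" and "K = P ^ l"
  have a: "a \<ge> 2" using P by simp
  have X: "X \<ge> 1" and K: "K \<ge> 1" and Y: "0 \<le> Y" "Y \<le> X"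
    using P a by (auto simp: X_def Y_def K_def intro!: one_le_power power_mono)
  have "P \<le> 2 * a" using P by simp
  also have "\<dots> \<le> a\<^sup>2" using a by (simp add: power2_eq_square)
  finally have aP: "P \<le> a\<^sup>2" .
  have "X \<le> P * X - a * Y"
    using mult_left_mono[OF Y(2), of a] a P(2) by (simp add: algebra_simps)
  then have "P * X \<le> a\<^sup>2 * (P * X - a * Y)"
    using P X by (intro mult_mono aP) auto
  then have "P ^ 3 * X \<le> P\<^sup>2 * (a\<^sup>2 * (P * X - a * Y))"
    using mult_left_mono[of _ _ "P\<^sup>2"] by (simp add: power3_eq_cube power2_eq_square mult.assoc)
  also have "\<dots> \<le> K * (P\<^sup>2 * (a\<^sup>2 * (P * X - a * Y)))"
    using mult_right_mono[OF K, of "P\<^sup>2 * (a\<^sup>2 * (P * X - a * Y))"]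
      \<open>X \<le> P * X - a * Y\<close> X by simp
  finally have main: "P ^ 3 * X \<le> K * (P\<^sup>2 * (a\<^sup>2 * (P * X - a * Y)))" .
  have "0 \<le> a ^ 3 * Y" using a Y by simp
  with main have "P ^ 3 * X - 1 - a ^ 3 * Y \<le> K * (P\<^sup>2 * (a\<^sup>2 * (P * X - a * Y)))" by linarith
  moreover have "P ^ m = P ^ 3 * X" "a ^ m = a ^ 3 * Y" "P ^ (n - m) = P * K"
    "P ^ (n - 1) = P ^ 3 * X * K" "P ^ n = P * (P ^ 3 * X * K)"
    by (auto simp: j l X_def Y_def K_def power_add eval_nat_numeral)
  ultimately show ?thesis
    unfolding P(2) by (simp add: algebra_simps power2_eq_square power3_eq_cube)
qed

text \<open>The case \<open>m = 2\<close>: all terms involving \<open>n\<close> cancel.\<close>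

lemma weight_comparison_eq_2:
  fixes P a :: real
  assumes P: "P = a + 1" and n: "3 \<le> n"
  shows "P * (P ^ n + a - P ^ (n - 1) - a * P ^ (n - 2) - 1)
           \<le> a * (P ^ n + P\<^sup>2 - P ^ (n - 1) - a\<^sup>2 - 1)"
proof -
  obtain l where l: "n = Suc (Suc l)" using less_imp_Suc_add[of 1 n] n by auto
  have "a * (P ^ n + P\<^sup>2 - P ^ (n - 1) - a\<^sup>2 - 1)
          - P * (P ^ n + a - P ^ (n - 1) - a * P ^ (n - 2) - 1) = a\<^sup>2 + 1"
    unfolding l P by (simp add: algebra_simps power2_eq_square)
  then show ?thesis using zero_le_power2[of a] by linarith
qed

theorem proposition5p8:
  fixes p n m :: nat
    and I :: "nat multiset"
    and f :: "(nat \<Rightarrow> 'p::prime_card mod_ring) \<Rightarrow> 'p mod_ring"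
  assumes "p = CARD('p)" and "odd p"
    and "n \<ge> 3" and "2 \<le> m" and "m \<le> n - 1"
    and "unsaturated_ideal p n (hierarchical_le m n) I"
    and "\<forall>i\<in>{1..n}. count I i = p - 1"
    and "f = indicator (ideals_within n (hierarchical_le m n) I - {zero_vec n})"
  shows "\<not> ashikhmin_barg (Fp_space n - {zero_vec n}) (function_code n f)"
proof -
  let ?D = "Fp_space n - {zero_vec n} :: (nat \<Rightarrow> 'p mod_ring) set"
  define wt where "wt u = hamming_weight ?D (ideal_word m n u)" for u
  let ?e = "\<lambda>k. \<lambda>i\<in>{1..n}. if i = k then 1 else 0 :: 'p mod_ring"
  have mn: "m < n" using assms(3,5) by linarith
  have p3: "p \<ge> 3"
  proof -
    have "p \<ge> 2" using prime_card[where 'a='p] assms(1) by (simp add: prime_ge_2_nat)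
    moreover have "p \<noteq> 2" using assms(2) by auto
    ultimately show ?thesis by linarith
  qed
  obtain a where a: "p = Suc a" using p3 by (cases p) auto
  have f: "f = indicator (hier_set m n - {zero_vec n})"
    using ideals_within_full[of m n I, where 'p='p] assms(1,7,8) mn by simp
  have D: "finite ?D" by (simp add: finite_Fp_space)
  have e: "?e k \<in> Fp_space n" for k by (simp add: Fp_space_def)
  have last: "wt (?e n) + p ^ (n - 1) + a ^ m + 1 = p ^ n + p ^ m"
    using weight_ideal_word_last[OF mn, where 'p='p] by (simp add: wt_def a flip: assms(1))
  have "p ^ (n - 1) < p ^ n" using p3 mn by (intro power_strict_increasing) auto
  moreover have "a ^ m < p ^ m" using a assms(4) by (intro power_strict_mono) auto
  ultimately have last_pos: "wt (?e n) > 0" using last by linarith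
  have last_real:
    "real (wt (?e n)) = real p ^ n + real p ^ m - real p ^ (n - 1) - real a ^ m - 1"
    using arg_cong[OF last, of real] by simp
  have pa: "real p = real a + 1" by (simp add: a)
  \<comment> \<open>The word with \<open>u = e\<^sub>n\<close> is the heavy one in both cases; only the light one varies.\<close>
  have conclude: ?thesis
    if "u \<in> Fp_space n" "wt u > 0" "real p * real (wt u) \<le> real a * real (wt (?e n))" for u
    unfolding f
  proof (rule not_ashikhmin_bargI[OF D ideal_word_mem ideal_word_mem])
    show "u \<in> Fp_space n" "?e n \<in> Fp_space n" by (fact that(1) e)+
  qed (use that last_pos pa in \<open>simp_all add: wt_def assms(1)\<close>)
  show ?thesis
  proof (cases "m = 2")
    case True
    have "wt (?e 1) + p ^ (n - 1) + a * p ^ (n - 2) + 1 = p ^ n + a"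
      using weight_ideal_word_first[of m n, where 'p='p] mn True
      by (simp add: wt_def a flip: assms(1))
    from arg_cong[OF this, of real]
    have first: "real (wt (?e 1))
        = real p ^ n + real a - real p ^ (n - 1) - real a * real p ^ (n - 2) - 1"
      by simp
    obtain l where l: "n = Suc (Suc l)" using less_imp_Suc_add[of 1 n] assms(3) by auto
    have "real p ^ n + real a - real p ^ (n - 1) - real a * real p ^ (n - 2) - 1
        = real a ^ 2 * real p ^ l + real a - 1"
      unfolding l pa by (simp add: algebra_simps power2_eq_square)
    then have "real (wt (?e 1)) = real a ^ 2 * real p ^ l + real a - 1"
      unfolding first .
    moreover have "real a ^ 2 * real p ^ l \<ge> 0" "real a \<ge> 2" using p3 a by auto
    ultimately have "wt (?e 1) > 0" by linarith
    then show ?thesis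
    proof (rule conclude[OF e])
      show "real p * real (wt (?e 1)) \<le> real a * real (wt (?e n))"
        using weight_comparison_eq_2[OF pa assms(3)] unfolding first last_real True .
    qed
  next
    case False
    then have m3: "3 \<le> m" using assms(4) by linarith
    let ?z = "zero_vec n :: nat \<Rightarrow> 'p mod_ring"
    have zero: "wt ?z + a ^ m + 1 = p ^ m + a ^ m * p ^ (n - m)"
      using weight_ideal_word_zero[of m n, where 'p='p] mn by (simp add: wt_def a flip: assms(1))
    have "p \<le> p ^ m" using p3 m3 by (intro self_le_power) auto
    moreover have "a ^ m \<le> a ^ m * p ^ (n - m)"
      using p3 by simp
    ultimately have pos: "wt ?z > 0" using zero p3 by linarith
    have zero_real:
      "real (wt ?z) = real p ^ m + real a ^ m * real p ^ (n - m) - real a ^ m - 1"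
      using arg_cong[OF zero, of real] by simp
    have "real p \<ge> 3" using p3 by simp
    from weight_comparison_ge_3[OF this pa m3 mn]
    have "real p * real (wt ?z) \<le> real a * real (wt (?e n))"
      unfolding zero_real last_real .
    then show ?thesis using pos by (intro conclude) (auto simp: zero_vec_def Fp_space_def)
  qed
qed

end
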